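(* Let $A\in\mathbb{C}^{n\times n}$ with $\operatorname{rk}A=s$ and $\operatorname{Ind}A=k$, and suppose the right core EP inverse $X=(x_{ij})$ and the left core EP inverse $Y=(y_{ij})$ of $A$ exist. Then for all $i,j\in\{1,\dots,n\}$ $$x_{ij}=\frac{\sum_{\alpha\in I_{s,n}\{j\}}\left|\left(A^{k+1}(A^{k+1})^{*}\right)_{j.}(\hat a_{i.})\right|_{\alpha}^{\alpha}}{\sum_{\alpha\in I_{s,n}}\left|A^{k+1}(A^{k+1})^{*}\right|_{\alpha}^{\alpha}},\qquad y_{ij}=\frac{\sum_{\beta\in J_{s,n}\{i\}}\left|\left((A^{k+1})^{*}A^{k+1}\right)_{.i}(\check a_{.j})\right|_{\beta}^{\beta}}{\sum_{\beta\in J_{s,n}}\left|(A^{k+1})^{*}A^{k+1}\right|_{\beta}^{\beta}},$$ where $\hat a_{i.}$ is the $i$th row of $\hat A=A^{k}(A^{k+1})^{*}$ and $\check a_{.j}$ is the $j$th column of $\check A=(A^{k+1})^{*}A^{k}$. If $\operatorname{Ind}A=1$, then the right core inverse $X'=(x'_{ij})$ and the left core inverse $Y'=(y'_{ij})$ of $A$ satisfy, for all $i,j$, $$x'_{ij}=\frac{\sum_{\alpha\in I_{s,n}\{j\}}\left|\left(A^{2}(A^{2})^{*}\right)_{j.}(\hat a'_{i.})\right|_{\alpha}^{\alpha}}{\sum_{\alpha\in I_{s,n}}\left|A^{2}(A^{2})^{*}\right|_{\alpha}^{\alpha}},\qquad y'_{ij}=\frac{\sum_{\beta\in J_{s,n}\{i\}}\left|\left((A^{2})^{*}A^{2}\right)_{.i}(\check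 a'_{.j})\right|_{\beta}^{\beta}}{\sum_{\beta\in J_{s,n}}\left|(A^{2})^{*}A^{2}\right|_{\beta}^{\beta}},$$ where $\hat a'_{i.}$ is the $i$th row of $A(A^{2})^{*}$ and $\check a'_{.j}$ is the $j$th column of $(A^{2})^{*}A$.
   Context: $A^{*}$ is the conjugate transpose, $\operatorname{rk}A$ the rank, $A^{\dagger}$ the Moore-Penrose inverse. $\operatorname{Ind}A$ is the smallest nonnegative integer $k$ with $\operatorname{rk}A^{k+1}=\operatorname{rk}A^{k}$ (with $A^0$ the identity), and $A^{d}$ is the Drazin inverse: the unique $X$ with $XAX=X$, $AX=XA$, $XA^{k+1}=A^{k}$. Put $\mathcal{R}_r(A)=\{Ax: x\in\mathbb{C}^{n\times 1}\}$ and $\mathcal{R}_l(A)=\{xA: x\in\mathbb{C}^{1\times n}\}$. The right core EP inverse of $A$ is the matrix $X$ with $XAX=X$ and $\mathcal{R}_r(X)=\mathcal{R}_r(X^{*})=\mathcal{R}_r(A^{d})$. The left core EP inverse is the matrix $Y$ with $YAY=Y$ and $\mathcal{R}_l(Y)=\mathcal{R}_l(Y^{*})=\mathcal{R}_l(A^{d})$. The right core inverse is the matrix $X'$ with $AX'=AA^{\dagger}$ and $\mathcal{R}_r(X')=\mathcal{R}_r(A)$; the left core inverse is the matrix $Y'$ with $Y'A=A^{\dagger}A$ and $\mathcal{R}_l(Y')=\mathcal{R}_l(A)$. For $1\le k\le n$, $I_{k,n}=J_{k,n}$ is the set of all $k$-element subsets of $\{1,\dots,n\}$, and $I_{k,n}\{j\}=J_{k,n}\{j\}$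 is the collection of those containing $j$. For a square matrix $M$, $|M|_\alpha^\alpha$ is the determinant of the principal submatrix of $M$ with rows and columns indexed by $\alpha$. $M_{j.}(b)$ is $M$ with its $j$th row replaced by the row $b$, $M_{.i}(c)$ is $M$ with its $i$th column replaced by the column $c$, and $|M_{j.}(b)|_\alpha^\alpha$, $|M_{.i}(c)|_\beta^\beta$ are the corresponding principal minors of the modified matrices.
   Formalization: In the first display the minors have order rk A^k instead of s = rk A; for Ind A ≥ 2 all minors of order s of A^{k+1}(A^{k+1})* vanish and the stated quotient is 0/0, while for Ind A ≤ 1 the two orders agree. *)

theory Defs
  imports
    Complex_Main
    "Jordan_Normal_Form.Schur_Decomposition"
    "Jordan_Normal_Form.DL_Rank"
    "Jordan_Normal_Form.DL_Submatrix"
begin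

(* Matrices are zero-based: the index set {1,...,n} of the text is {..<n} here.
   The conjugate transpose is the library's mat_adjoint. *)

definition mat_rank :: "complex mat \<Rightarrow> nat" where
  "mat_rank A = vec_space.rank (dim_row A) A"

definition mat_index :: "complex mat \<Rightarrow> nat" where
  "mat_index A = (LEAST k. mat_rank (A ^\<^sub>m (k + 1)) = mat_rank (A ^\<^sub>m k))"

(* Column vectors are n x 1 matrices and row vectors are 1 x n matrices. *)

definition right_range :: "complex mat \<Rightarrow> complex mat set" where
  "right_range A = {A * x | x. x \<in> carrier_mat (dim_col A) 1}"

definition left_range :: "complex mat \<Rightarrow> complex mat set" where
  "left_range A = {x * A | x. x \<in> carrier_mat 1 (dim_row A)}"

(* The generalized inverses are rendered as predicates "X is the ... inverse of A",
   for square A. *)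

definition is_moore_penrose_inverse :: "complex mat \<Rightarrow> complex mat \<Rightarrow> bool" where
  "is_moore_penrose_inverse A P \<longleftrightarrow>
     P \<in> carrier_mat (dim_col A) (dim_row A) \<and>
     A * P * A = A \<and> P * A * P = P \<and>
     mat_adjoint (A * P) = A * P \<and> mat_adjoint (P * A) = P * A"

definition is_drazin_inverse :: "complex mat \<Rightarrow> complex mat \<Rightarrow> bool" where
  "is_drazin_inverse A D \<longleftrightarrow>
     D \<in> carrier_mat (dim_row A) (dim_row A) \<and>
     D * A * D = D \<and> A * D = D * A \<and>
     D * A ^\<^sub>m (mat_index A + 1) = A ^\<^sub>m (mat_index A)"

definition is_right_core_EP_inverse :: "complex mat \<Rightarrow> complex mat \<Rightarrow> bool" where
  "is_right_core_EP_inverse A X \<longleftrightarrow>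
     X \<in> carrier_mat (dim_row A) (dim_row A) \<and> X * A * X = X \<and>
     (\<exists>D. is_drazin_inverse A D \<and>
          right_range X = right_range (mat_adjoint X) \<and>
          right_range (mat_adjoint X) = right_range D)"

definition is_left_core_EP_inverse :: "complex mat \<Rightarrow> complex mat \<Rightarrow> bool" where
  "is_left_core_EP_inverse A Y \<longleftrightarrow>
     Y \<in> carrier_mat (dim_row A) (dim_row A) \<and> Y * A * Y = Y \<and>
     (\<exists>D. is_drazin_inverse A D \<and>
          left_range Y = left_range (mat_adjoint Y) \<and>
          left_range (mat_adjoint Y) = left_range D)"

definition is_right_core_inverse :: "complex mat \<Rightarrow> complex mat \<Rightarrow> bool" where
  "is_right_core_inverse A X \<longleftrightarrow>
     X \<in> carrier_mat (dim_row A) (dim_row A) \<and>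
     (\<exists>P. is_moore_penrose_inverse A P \<and> A * X = A * P) \<and>
     right_range X = right_range A"

definition is_left_core_inverse :: "complex mat \<Rightarrow> complex mat \<Rightarrow> bool" where
  "is_left_core_inverse A Y \<longleftrightarrow>
     Y \<in> carrier_mat (dim_row A) (dim_row A) \<and>
     (\<exists>P. is_moore_penrose_inverse A P \<and> Y * A = P * A) \<and>
     left_range Y = left_range A"

(* For m = 0 the first family is {{}} and the second is empty; the empty minor is 1. *)

definition index_sets :: "nat \<Rightarrow> nat \<Rightarrow> nat set set" where
  "index_sets m n = {\<alpha>. \<alpha> \<subseteq> {..<n} \<and> card \<alpha> = m}"

definition index_sets_at :: "nat \<Rightarrow> nat \<Rightarrow> nat \<Rightarrow> nat set set" where
  "index_sets_at m n j = {\<alpha> \<in> index_sets m n. j \<in> \<alpha>}"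

definition principal_minor :: "complex mat \<Rightarrow> nat set \<Rightarrow> complex" where
  "principal_minor M \<alpha> = det (submatrix M \<alpha> \<alpha>)"

(* Row counterpart of the library's replace_col, with the same argument order. *)

definition replace_row :: "complex mat \<Rightarrow> complex vec \<Rightarrow> nat \<Rightarrow> complex mat" where
  "replace_row M b k =
     mat (dim_row M) (dim_col M) (\<lambda>(i, j). if i = k then b $ j else M $$ (i, j))"

end

(* For M of rank r and x in the column space of M, Cramer's rule for M + t I has a
   well-defined coefficient at t^(n - r): the numerator is a sum of principal minors of
   order r of M with a column replaced by M x, the denominator is the sum E_r(M) of all of them,
   and the correction term consists of minors of order r + 1 of a matrix of rank at most r.
   If B = P G is a full-rank factorization, Sylvester's determinant identity gives
   E_r(B B* ) = det(P* P) det(G G* ), which is nonzero.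

   It remains to see that the generalized inverses solve the right systems: for B = A^(k+1) a
   right core EP inverse satisfies X B = A^k and has its rows in the row space of B*, and
   similarly for the left version.  For the core inverses (k = 1) the same holds because
   rk A^2 = rk A makes A both a left and a right multiple of A^2. *)

theory Submission
  imports Defs
begin

subsection \<open>Determinants and principal minors\<close>

lemma permutes_less_nat: "p permutes {0..<n} \<Longrightarrow> i < n \<Longrightarrow> p i < (n :: nat)"
  using permutes_in_image[of p "{0..<n}" i] by simp

text \<open>\<open>pick S\<close> conjugates permutations of {0..<card S} to permutations of S with
  the same sign. Indexing the Leibniz formula by S itself allows minors of different orders to be
  compared within one expansion of a determinant.\<close>

lemma det_submatrix_permutes:
  fixes M :: "'a :: comm_ring_1 mat"
  assumes M: "M \<in> carrier_mat n n" and S: "S \<subseteq> {..<n}"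
  shows "det (submatrix M S S) = (\<Sum>p | p permutes S. signof p * (\<Prod>i\<in>S. M $$ (i, p i)))"
proof -
  let ?m = "card S"
  let ?f = "pick S"
  have fin: "finite S" using S finite_subset by blast
  have Sn: "{i. i < n \<and> i \<in> S} = S" using S by auto
  have inj: "inj_on ?f {0..<?m}"
    by (rule inj_onI) (metis atLeastLessThan_iff linorder_neqE_nat nat_less_le pick_mono_le)
  have "?f ` {0..<?m} \<subseteq> S" using pick_in_set_le by auto
  then have img: "?f ` {0..<?m} = S"
    by (intro card_subset_eq fin) (simp_all add: card_image[OF inj])
  have bij: "bij_betw ?f {0..<?m} S" using inj img by (simp add: bij_betw_def)
  define g where "g = inv_into {0..<?m} ?f"
  have bijg: "bij_betw g S {0..<?m}" unfolding g_def by (rule bij_betw_inv_into[OF bij])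
  have gf: "g (?f i) = i" if "i \<in> {0..<?m}" for i using that inj by (simp add: g_def)
  have fg: "?f (g i) = i" if "i \<in> S" for i using that img by (simp add: g_def f_inv_into_f)
  have sub: "submatrix M S S = mat ?m ?m (\<lambda>(i, j). M $$ (?f i, ?f j))"
    unfolding submatrix_def using M Sn by auto
  have "det (submatrix M S S) = (\<Sum>p | p permutes {0..<?m}.
      signof p * (\<Prod>i = 0..<?m. M $$ (?f i, ?f (p i))))"
    unfolding sub by (subst det_def'[of _ ?m])
      (auto intro!: sum.cong prod.cong simp: permutes_less_nat)
  also have "\<dots> = (\<Sum>p | p permutes S. signof p * (\<Prod>i\<in>S. M $$ (i, p i)))"
  proof (rule sum.reindex_bij_witness[where j = "map_permutation {0..<?m} ?f" and i = "map_permutation S g"])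
    fix p assume p: "p \<in> {p. p permutes {0..<?m}}"
    show "map_permutation S g (map_permutation {0..<?m} ?f p) = p"
      using p by (intro map_permutation_compose_inv[OF bij] gf) auto
    show "map_permutation {0..<?m} ?f p \<in> {p. p permutes S}"
      using p map_permutation_permutes[OF bij] by auto
    have "(\<Prod>i\<in>S. M $$ (i, map_permutation {0..<?m} ?f p i))
        = (\<Prod>i = 0..<?m. M $$ (?f i, map_permutation {0..<?m} ?f p (?f i)))"
      by (subst prod.reindex_bij_betw[OF bij, symmetric]) simp
    also have "\<dots> = (\<Prod>i = 0..<?m. M $$ (?f i, ?f (p i)))"
      by (intro prod.cong refl) (simp add: map_permutation_apply[OF inj])
    finally show "signof (map_permutation {0..<?m} ?f p) * (\<Prod>i\<in>S. M $$ (i, map_permutation {0..<?m} ?f p i))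
        = signof p * (\<Prod>i = 0..<?m. M $$ (?f i, ?f (p i)))"
      using p by (simp add: sign_map_permutation[OF inj])
  next
    fix p assume p: "p \<in> {p. p permutes S}"
    show "map_permutation {0..<?m} ?f (map_permutation S g p) = p"
      using p by (intro map_permutation_compose_inv[OF bijg] fg) auto
    show "map_permutation S g p \<in> {p. p permutes {0..<?m}}"
      using p map_permutation_permutes[OF bijg] by auto
  qed
  finally show ?thesis .
qed

lemma det_submatrix_full:
  fixes M :: "'a :: comm_ring_1 mat"
  assumes M: "M \<in> carrier_mat n n"
  shows "det (submatrix M {..<n} {..<n}) = det M"
  using det_submatrix_permutes[OF M, of "{..<n}"] det_def'[OF M] by (simp add: lessThan_atLeast0)

text \<open>Multiply out the Leibniz products, with S the set of rows that contribute an entry of M.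
  The remaining rows contribute diagonal entries, so only permutations fixing every point outside S
  survive, and these add up to the principal minor at S.\<close>

lemma det_add_diag:
  fixes M :: "'a :: comm_ring_1 mat"
  assumes M: "M \<in> carrier_mat n n"
  shows "det (M + mat n n (\<lambda>(i, j). if i = j then v i else 0)) =
    (\<Sum>S\<in>Pow {..<n}. det (submatrix M S S) * (\<Prod>i\<in>{..<n} - S. v i))"
proof -
  let ?N = "M + mat n n (\<lambda>(i, j). if i = j then v i else 0)"
  let ?d = "\<lambda>p i. if i = p i then v i else 0"
  let ?t = "\<lambda>p S. signof p * ((\<Prod>i\<in>S. M $$ (i, p i)) * (\<Prod>i\<in>{..<n} - S. ?d p i))"
  have N: "?N \<in> carrier_mat n n" using M by auto
  have "det ?N = (\<Sum>p | p permutes {..<n}. signof p * (\<Prod>i<n. M $$ (i, p i) + ?d p i))"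
    unfolding det_def'[OF N] lessThan_atLeast0 using M
    by (intro sum.cong refl arg_cong2[of _ _ _ _ "(*)"] prod.cong) (auto simp: permutes_less_nat)
  also have "\<dots> = (\<Sum>p | p permutes {..<n}. \<Sum>S\<in>Pow {..<n}. ?t p S)"
    by (simp add: prod_add sum_distrib_left)
  also have "\<dots> = (\<Sum>S\<in>Pow {..<n}. \<Sum>p | p permutes {..<n}. ?t p S)"
    by (rule sum.swap)
  also have "\<dots> = (\<Sum>S\<in>Pow {..<n}. det (submatrix M S S) * (\<Prod>i\<in>{..<n} - S. v i))"
  proof (rule sum.cong[OF refl])
    fix S assume "S \<in> Pow {..<n}"
    then have S: "S \<subseteq> {..<n}" by simp
    have "(\<Sum>p | p permutes {..<n}. ?t p S) = (\<Sum>p | p permutes S. ?t p S)"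
    proof (rule sum.mono_neutral_right)
      show "finite {p. p permutes {..<n}}" by (simp add: finite_permutations)
      show "{p. p permutes S} \<subseteq> {p. p permutes {..<n}}" using S permutes_subset by blast
      show "\<forall>p\<in>{p. p permutes {..<n}} - {p. p permutes S}. ?t p S = 0"
      proof
        fix p assume p: "p \<in> {p. p permutes {..<n}} - {p. p permutes S}"
        then obtain i where "i \<in> {..<n} - S" "p i \<noteq> i" using permutes_superset by blast
        then have "(\<Prod>i\<in>{..<n} - S. ?d p i) = 0" by (intro prod_zero bexI[of _ i]) auto
        then show "?t p S = 0" by simp
      qed
    qed
    also have "\<dots> = (\<Sum>p | p permutes S. signof p * (\<Prod>i\<in>S. M $$ (i, p i)) * (\<Prod>i\<in>{..<n} - S. v i))"
    proof (rule sum.cong[OF refl])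
      fix p assume "p \<in> {p. p permutes S}"
      then have "(\<Prod>i\<in>{..<n} - S. ?d p i) = (\<Prod>i\<in>{..<n} - S. v i)"
        by (intro prod.cong refl) (auto simp: permutes_not_in)
      then show "?t p S = signof p * (\<Prod>i\<in>S. M $$ (i, p i)) * (\<Prod>i\<in>{..<n} - S. v i)"
        by (simp add: mult.assoc)
    qed
    also have "\<dots> = det (submatrix M S S) * (\<Prod>i\<in>{..<n} - S. v i)"
      by (simp add: det_submatrix_permutes[OF M S] sum_distrib_right)
    finally show "(\<Sum>p | p permutes {..<n}. ?t p S) = det (submatrix M S S) * (\<Prod>i\<in>{..<n} - S. v i)" .
  qed
  finally show ?thesis .
qed

text \<open>Padding both factors with zeros to size a by a leaves the product unchanged and gives
  the left factor a zero column.\<close>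

lemma det_mult_zero_if_inner_dim_less:
  fixes U V :: "'a :: comm_ring_1 mat"
  assumes U: "U \<in> carrier_mat a b" and V: "V \<in> carrier_mat b a" and ba: "b < a"
  shows "det (U * V) = 0"
proof -
  define U' where "U' = mat a a (\<lambda>(i, j). if j < b then U $$ (i, j) else 0)"
  define V' where "V' = mat a a (\<lambda>(i, j). if i < b then V $$ (i, j) else 0)"
  have carr: "U' \<in> carrier_mat a a" "V' \<in> carrier_mat a a" by (auto simp: U'_def V'_def)
  have "U * V = U' * V'"
  proof (rule eq_matI)
    fix i j assume "i < dim_row (U' * V')" "j < dim_col (U' * V')"
    then have ij: "i < a" "j < a" by (auto simp: U'_def V'_def)
    have "(U * V) $$ (i, j) = (\<Sum>k = 0..<b. U $$ (i, k) * V $$ (k, j))"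
      using U V ij by (auto simp: scalar_prod_def intro!: sum.cong)
    also have "\<dots> = (\<Sum>k = 0..<a. U' $$ (i, k) * V' $$ (k, j))"
      using ba ij by (intro sum.mono_neutral_cong_left) (auto simp: U'_def V'_def)
    also have "\<dots> = (U' * V') $$ (i, j)"
      using carr ij by (auto simp: scalar_prod_def intro!: sum.cong)
    finally show "(U * V) $$ (i, j) = (U' * V') $$ (i, j)" .
  qed (use U V in \<open>auto simp: U'_def V'_def\<close>)
  \<comment> \<open>Column b is the first padded one; it exists because b < a.\<close>
  moreover have "det U' = 0"
    by (subst laplace_expansion_column[OF carr(1) ba]) (use ba in \<open>auto simp: U'_def\<close>)
  ultimately show ?thesis by (simp add: det_mult[OF carr])
qed

text \<open>Picking rows of P and columns of Q factors the submatrix through dimension r, which is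
  below its size.\<close>

lemma det_submatrix_mult_zero:
  fixes P Q :: "'a :: comm_ring_1 mat"
  assumes P: "P \<in> carrier_mat n r" and Q: "Q \<in> carrier_mat r n"
    and S: "S \<subseteq> {..<n}" and card: "r < card S"
  shows "det (submatrix (P * Q) S S) = 0"
proof -
  let ?m = "card S"
  have Sn: "{i. i < n \<and> i \<in> S} = S" using S by auto
  have pick: "pick S i < n" if "i < ?m" for i using pick_in_set_le[OF that] S by auto
  have "submatrix (P * Q) S S =
      mat ?m r (\<lambda>(i, j). P $$ (pick S i, j)) * mat r ?m (\<lambda>(i, j). Q $$ (i, pick S j))"
    unfolding submatrix_def using P Q pick
    by (intro eq_matI) (auto simp: Sn scalar_prod_def intro!: sum.cong)
  then show ?thesis
    by (simp add: det_mult_zero_if_inner_dim_less[OF _ _ card])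
qed

text \<open>Both determinants come from the one block matrix \<open>?F\<close>: the factor
  \<open>?R\<close>, of determinant 1, exposes t I + P Q, and the factor \<open>?L\<close>, of
  determinant t^r, exposes t I + Q P. Keeping the powers of t avoids a division and covers t =
  0.\<close>

lemma sylvester_determinant:
  fixes P Q :: "'a :: idom mat"
  assumes P: "P \<in> carrier_mat n r" and Q: "Q \<in> carrier_mat r n"
  shows "t ^ r * det (t \<cdot>\<^sub>m 1\<^sub>m n + P * Q) = t ^ n * det (t \<cdot>\<^sub>m 1\<^sub>m r + Q * P)"
proof -
  let ?F = "four_block_mat (t \<cdot>\<^sub>m 1\<^sub>m n) (- P) Q (1\<^sub>m r)"
  let ?R = "four_block_mat (1\<^sub>m n) (0\<^sub>m n r) (- Q) (1\<^sub>m r)"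
  let ?L = "four_block_mat (1\<^sub>m n) (0\<^sub>m n r) (- Q) (t \<cdot>\<^sub>m 1\<^sub>m r)"
  have F: "?F \<in> carrier_mat (n + r) (n + r)" and R: "?R \<in> carrier_mat (n + r) (n + r)"
    and L: "?L \<in> carrier_mat (n + r) (n + r)" by auto
  have "?F * ?R = four_block_mat (t \<cdot>\<^sub>m 1\<^sub>m n + P * Q) (- P) (0\<^sub>m r n) (1\<^sub>m r)"
    using P Q by (subst mult_four_block_mat[where ?nr1.0 = n and ?n1.0 = n and ?n2.0 = r and ?nr2.0 = r])
      (auto intro!: cong_four_block_mat simp: uminus_l_inv_mat)
  then have 1: "det ?F = det (t \<cdot>\<^sub>m 1\<^sub>m n + P * Q)"
    using det_mult[OF F R] P Q
    by (simp add: det_four_block_mat_lower_left_zero[where n = n and m = r]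
        det_four_block_mat_upper_right_zero[where n = n and m = r])
  have "?L * ?F = four_block_mat (t \<cdot>\<^sub>m 1\<^sub>m n) (- P) (0\<^sub>m r n) (t \<cdot>\<^sub>m 1\<^sub>m r + Q * P)"
    using P Q by (subst mult_four_block_mat[where ?nr1.0 = n and ?n1.0 = n and ?n2.0 = r and ?nr2.0 = r])
      (auto intro!: cong_four_block_mat eq_matI)
  then have 2: "t ^ r * det ?F = t ^ n * det (t \<cdot>\<^sub>m 1\<^sub>m r + Q * P)"
    using det_mult[OF L F] P Q
    by (simp add: det_four_block_mat_lower_left_zero[where n = n and m = r]
        det_four_block_mat_upper_right_zero[where n = n and m = r])
  show ?thesis using 1 2 by simp
qed

section \<open>Sums of principal minors as polynomial coefficients\<close>

lemma index_sets_empty: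
  assumes "n < m"
  shows "index_sets m n = {}"
proof -
  have "S \<notin> index_sets m n" for S
    using assms card_mono[of "{..<n}" S] by (auto simp: index_sets_def)
  then show ?thesis by blast
qed

text \<open>Evaluated at \<open>t\<close> this is the determinant of \<open>M\<close> with \<open>t\<close> added to the diagonal entries
  outside \<open>J\<close>, so the sums of principal minors containing \<open>J\<close> are its coefficients.\<close>

definition shifted_minor_poly :: "complex mat \<Rightarrow> nat set \<Rightarrow> complex poly" where
  "shifted_minor_poly M J =
     (\<Sum>S | J \<subseteq> S \<and> S \<subseteq> {..<dim_row M}. monom (principal_minor M S) (dim_row M - card S))"

lemma poly_shifted_minor_poly:
  assumes M: "M \<in> carrier_mat n n" and J: "J \<subseteq> {..<n}"
  shows "poly (shifted_minor_poly M J) t =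
    det (M + mat n n (\<lambda>(i, j). if i = j then if i \<in> J then 0 else t else 0))"
proof -
  \<comment> \<open>An index of J outside S puts a zero shift into the product, so only the sets S
    containing J remain.\<close>
  have sel: "(\<Prod>i\<in>{..<n} - S. if i \<in> J then 0 else t) = (if J \<subseteq> S then t ^ (n - card S) else 0)"
    if S: "S \<subseteq> {..<n}" for S
  proof (cases "J \<subseteq> S")
    case True
    then have "(\<Prod>i\<in>{..<n} - S. if i \<in> J then 0 else t) = (\<Prod>i\<in>{..<n} - S. t)"
      by (intro prod.cong) auto
    then show ?thesis using True S by (simp add: card_Diff_subset finite_subset)
  next
    case False
    then obtain i where "i \<in> J" "i \<notin> S" by auto
    then have "(\<Prod>i\<in>{..<n} - S. if i \<in> J then 0 else t) = 0"
      using J by (intro prod_zero bexI[of _ i]) auto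
    then show ?thesis using False by simp
  qed
  have "det (M + mat n n (\<lambda>(i, j). if i = j then if i \<in> J then 0 else t else 0)) =
      (\<Sum>S\<in>Pow {..<n}. det (submatrix M S S) * (if J \<subseteq> S then t ^ (n - card S) else 0))"
    unfolding det_add_diag[OF M] by (intro sum.cong refl) (simp add: sel)
  also have "\<dots> = (\<Sum>S | J \<subseteq> S \<and> S \<subseteq> {..<n}. det (submatrix M S S) * t ^ (n - card S))"
    by (rule sum.mono_neutral_cong_right) auto
  also have "\<dots> = poly (shifted_minor_poly M J) t"
    using M by (simp add: shifted_minor_poly_def principal_minor_def poly_sum poly_monom)
  finally show ?thesis by simp
qed

lemma coeff_shifted_minor_poly:
  assumes M: "M \<in> carrier_mat n n" and m: "m \<le> n"
  shows "coeff (shifted_minor_poly M J) (n - m) = (\<Sum>S | S \<in> index_sets m n \<and> J \<subseteq> S. principal_minor M S)"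
proof -
  \<comment> \<open>The degrees use truncated subtraction; they determine the cardinality because
    both \<open>card S\<close> and m are at most n.\<close>
  have eq: "n - card S = n - m \<longleftrightarrow> card S = m" if "S \<subseteq> {..<n}" for S
    using card_mono[OF _ that] m by auto
  have "coeff (shifted_minor_poly M J) (n - m) =
      (\<Sum>S | J \<subseteq> S \<and> S \<subseteq> {..<n}. if card S = m then principal_minor M S else 0)"
    using M unfolding shifted_minor_poly_def by (auto simp: coeff_sum eq intro!: sum.cong)
  also have "\<dots> = (\<Sum>S | S \<in> index_sets m n \<and> J \<subseteq> S. principal_minor M S)"
    by (rule sum.mono_neutral_cong_right) (auto simp: index_sets_def intro: finite_subset[of _ "Pow {..<n}"])
  finally show ?thesis .
qed

lemma shifted_minor_poly_empty:
  assumes M: "M \<in> carrier_mat n n"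
  shows "poly (shifted_minor_poly M {}) t = det (M + t \<cdot>\<^sub>m 1\<^sub>m n)"
  unfolding poly_shifted_minor_poly[OF M empty_subsetI] using M
  by (intro arg_cong[of _ _ det] eq_matI) auto

section \<open>Cramer's rule with a shifted diagonal\<close>

lemma smult_one_mult_mat_vec:
  fixes x :: "'a :: comm_ring_1 vec"
  assumes "x \<in> carrier_vec n"
  shows "(t \<cdot>\<^sub>m 1\<^sub>m n) *\<^sub>v x = t \<cdot>\<^sub>v x"
  using assms by (intro eq_vecI) auto

text \<open>The cofactors along column j do not involve that column, so the Laplace expansion is
  linear in the inserted vector.\<close>

lemma det_replace_col_add:
  fixes N :: "'a :: comm_ring_1 mat"
  assumes N: "N \<in> carrier_mat n n" and u: "u \<in> carrier_vec n" and w: "w \<in> carrier_vec n" and j: "j < n"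
  shows "det (replace_col N (u + c \<cdot>\<^sub>v w) j) = det (replace_col N u j) + c * det (replace_col N w j)"
proof -
  have carr: "replace_col N b j \<in> carrier_mat n n" for b using N by (simp add: replace_col_def)
  have cof: "cofactor (replace_col N b j) i j = cofactor N i j" if "i < n" for b i
  proof -
    have "mat_delete (replace_col N b j) i j = mat_delete N i j"
      unfolding mat_delete_def using N that j by (intro eq_matI) (auto simp: replace_col_def)
    then show ?thesis by (simp add: cofactor_def)
  qed
  have ent: "replace_col N b j $$ (i, j) = b $ i" if "i < n" for b i
    using N that j by (simp add: replace_col_def)
  have "det (replace_col N b j) = (\<Sum>i<n. b $ i * cofactor N i j)" for b
    by (subst laplace_expansion_column[OF carr j]) (simp add: cof ent)
  then show ?thesis using u w
    by (simp add: sum_distrib_left sum.distrib algebra_simps)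
qed

text \<open>Cramer's rule for the matrix \<open>N = M + t I\<close>, whose column \<open>N x = M x + t x\<close> splits
  linearly; the identity compares coefficients in \<open>t\<close>.\<close>

lemma sum_minors_replace_col_mult:
  assumes M: "M \<in> carrier_mat n n" and x: "x \<in> carrier_vec n" and i: "i < n"
  shows "(\<Sum>\<beta>\<in>index_sets_at m n i. principal_minor (replace_col M (M *\<^sub>v x) i) \<beta>) =
    x $ i * (\<Sum>\<beta>\<in>index_sets m n. principal_minor M \<beta>) -
    (\<Sum>\<beta>\<in>index_sets_at (Suc m) n i. principal_minor (replace_col M x i) \<beta>)"
proof (cases "m \<le> n")
  case False
  then show ?thesis by (simp add: index_sets_at_def index_sets_empty)
next
  case m: True
  let ?R = "\<lambda>b. replace_col M b i"
  let ?q = "\<lambda>b. shifted_minor_poly (?R b) {i}"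
  have R: "?R b \<in> carrier_mat n n" for b using M by (simp add: replace_col_def)
  have at: "{S. S \<in> index_sets k n \<and> {i} \<subseteq> S} = index_sets_at k n i" for k
    by (auto simp: index_sets_at_def)
  \<comment> \<open>Column i of the shifted matrix is overwritten by b and so carries no t; this is
    why the polynomial is taken with J = {i}.\<close>
  have q: "poly (?q b) t = det (replace_col (M + t \<cdot>\<^sub>m 1\<^sub>m n) b i)" for b t
  proof -
    have "?R b + mat n n (\<lambda>(k, l). if k = l then if k \<in> {i} then 0 else t else 0) =
        replace_col (M + t \<cdot>\<^sub>m 1\<^sub>m n) b i"
      using M i by (intro eq_matI) (auto simp: replace_col_def)
    then show ?thesis using poly_shifted_minor_poly[OF R, of "{i}" b t] i by simp
  qed
  have "poly (?q (M *\<^sub>v x) + pCons 0 (?q x)) t = poly (smult (x $ i) (shifted_minor_poly M {})) t" for t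
  proof -
    let ?N = "M + t \<cdot>\<^sub>m 1\<^sub>m n"
    have N: "?N \<in> carrier_mat n n" using M by simp
    have "?N *\<^sub>v x = M *\<^sub>v x + t \<cdot>\<^sub>v x"
      by (subst add_mult_distrib_mat_vec[OF M _ x]) (simp_all add: smult_one_mult_mat_vec[OF x])
    then show ?thesis
      using cramer_lemma_mat[OF N x i] det_replace_col_add[OF N _ x i, of "M *\<^sub>v x" t] M x
      by (simp add: q shifted_minor_poly_empty[OF M])
  qed
  then have "?q (M *\<^sub>v x) + pCons 0 (?q x) = smult (x $ i) (shifted_minor_poly M {})"
    using poly_eq_poly_eq_iff by blast
  then have "coeff (?q (M *\<^sub>v x)) (n - m) + coeff (pCons 0 (?q x)) (n - m) =
      x $ i * coeff (shifted_minor_poly M {}) (n - m)"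
    by (metis coeff_add coeff_smult)
  \<comment> \<open>\<open>pCons 0\<close> multiplies by t, so the coefficient at n - m comes from
    degree n - Suc m, which belongs to the minors of order m + 1. For m = n there are none.\<close>
  moreover have "coeff (pCons 0 (?q x)) (n - m) =
      (\<Sum>\<beta>\<in>index_sets_at (Suc m) n i. principal_minor (?R x) \<beta>)"
  proof (cases "m = n")
    case True
    then show ?thesis by (simp add: index_sets_at_def index_sets_empty)
  next
    case False
    then have m': "Suc m \<le> n" using m by simp
    then obtain d where d: "n - m = Suc d" "n - Suc m = d" by (metis Suc_diff_Suc Suc_le_lessD)
    show ?thesis
      using coeff_shifted_minor_poly[OF R m', of x "{i}"] unfolding at d by simp
  qed
  moreover have "coeff (?q (M *\<^sub>v x)) (n - m) =
      (\<Sum>\<beta>\<in>index_sets_at m n i. principal_minor (?R (M *\<^sub>v x)) \<beta>)"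
    using coeff_shifted_minor_poly[OF R m, of "M *\<^sub>v x" "{i}"] unfolding at .
  moreover have "coeff (shifted_minor_poly M {}) (n - m) = (\<Sum>\<beta>\<in>index_sets m n. principal_minor M \<beta>)"
    using coeff_shifted_minor_poly[OF M m, of "{}"] by simp
  ultimately show ?thesis by (simp only: eq_diff_eq)
qed

text \<open>Comparison of the coefficients of t^n in Sylvester's identity. The left side contributes
  the principal minors of order r, the right side the constant term of det(t I + Q P).\<close>

lemma sum_minors_mult_eq_det:
  assumes P: "P \<in> carrier_mat n r" and Q: "Q \<in> carrier_mat r n" and rn: "r \<le> n"
  shows "(\<Sum>\<alpha>\<in>index_sets r n. principal_minor (P * Q) \<alpha>) = det (Q * P)"
proof -
  have PQ: "P * Q \<in> carrier_mat n n" and QP: "Q * P \<in> carrier_mat r r" using P Q by auto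
  have "poly (monom 1 r * shifted_minor_poly (P * Q) {}) t =
      poly (monom 1 n * shifted_minor_poly (Q * P) {}) t" for t
    using sylvester_determinant[OF P Q, of t] PQ QP
    by (simp add: poly_monom shifted_minor_poly_empty[OF PQ] shifted_minor_poly_empty[OF QP]
        comm_add_mat[of _ n n] comm_add_mat[of _ r r])
  then have "monom 1 r * shifted_minor_poly (P * Q) {} = monom 1 n * shifted_minor_poly (Q * P) {}"
    using poly_eq_poly_eq_iff by blast
  then have "coeff (monom 1 r * shifted_minor_poly (P * Q) {}) (n - r + r) =
      coeff (monom 1 n * shifted_minor_poly (Q * P) {}) (r - r + n)" using rn by simp
  then have "coeff (shifted_minor_poly (P * Q) {}) (n - r) = coeff (shifted_minor_poly (Q * P) {}) (r - r)"
    by (simp add: coeff_monom_mult)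
  moreover have "index_sets r r = {{..<r}}"
    using card_subset_eq[of "{..<r}"] by (auto simp: index_sets_def)
  moreover have "principal_minor (Q * P) {..<r} = det (Q * P)"
    by (simp add: principal_minor_def det_submatrix_full[OF QP])
  moreover note coeff_shifted_minor_poly[OF PQ rn, of "{}"] coeff_shifted_minor_poly[OF QP order_refl, of "{}"]
  ultimately show ?thesis by simp
qed

subsection \<open>Cramer's rule for matrices of low rank\<close>

text \<open>If the columns of the solution lie in the column space of \<open>P * Q\<close>, replacing a column of \<open>P * Q\<close> by
  one of them does not raise the rank, so the remainder of order \<open>r + 1\<close> in
  \<open>sum_minors_replace_col_mult\<close> vanishes.\<close>

lemma cramer_rule_low_rank_col:
  assumes P: "P \<in> carrier_mat n r" and Q: "Q \<in> carrier_mat r n" and det: "det (Q * P) \<noteq> 0"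
    and W: "W \<in> carrier_mat r n" and i: "i < n" and j: "j < n"
  shows "(P * W) $$ (i, j) =
    (\<Sum>\<beta>\<in>index_sets_at r n i. principal_minor (replace_col (P * Q) (col (P * Q * (P * W)) j) i) \<beta>) /
    (\<Sum>\<beta>\<in>index_sets r n. principal_minor (P * Q) \<beta>)"
proof -
  \<comment> \<open>\<open>Q * P\<close> has size r and inner dimension n, so it would be singular
    if n < r.\<close>
  have rn: "r \<le> n" using det det_mult_zero_if_inner_dim_less[OF Q P] by linarith
  have PQ: "P * Q \<in> carrier_mat n n" and PW: "P * W \<in> carrier_mat n n" using P Q W by auto
  have "replace_col (P * Q) (col (P * W) j) i = P * replace_col Q (col W j) i"
    using P Q W i j by (intro eq_matI) (auto simp: replace_col_def scalar_prod_def intro!: sum.cong)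
  then have "principal_minor (replace_col (P * Q) (col (P * W) j) i) \<beta> = 0"
    if "\<beta> \<in> index_sets_at (Suc r) n i" for \<beta>
    using that det_submatrix_mult_zero[OF P, of "replace_col Q (col W j) i" \<beta>] Q
    by (simp add: principal_minor_def index_sets_at_def index_sets_def replace_col_def)
  moreover have "col (P * Q * (P * W)) j = P * Q *\<^sub>v col (P * W) j"
    using col_mult2[OF PQ PW j] .
  moreover have "col (P * W) j \<in> carrier_vec n" using PW j by auto
  ultimately show ?thesis
    using sum_minors_replace_col_mult[OF PQ _ i, of "col (P * W) j" r]
      sum_minors_mult_eq_det[OF P Q rn] det P W i j
    by simp
qed

lemma principal_minor_transpose:
  assumes M: "M \<in> carrier_mat n n"
  shows "principal_minor M\<^sup>T S = principal_minor M S"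
proof -
  let ?m = "card {i. i < n \<and> i \<in> S}"
  have carr: "submatrix M S S \<in> carrier_mat ?m ?m" using M by (auto simp: submatrix_def)
  have "submatrix M\<^sup>T S S = (submatrix M S S)\<^sup>T"
    using M pick_le by (intro eq_matI) (auto simp: submatrix_def)
  then show ?thesis by (simp add: principal_minor_def det_transpose[OF carr])
qed

lemma transpose_replace_col:
  assumes "M \<in> carrier_mat n n"
  shows "(replace_col M\<^sup>T b j)\<^sup>T = replace_row M b j"
  using assms by (intro eq_matI) (auto simp: replace_col_def replace_row_def)

text \<open>Transposition swaps the roles of P and Q, turns the replaced row into a replaced column
  and leaves principal minors unchanged. Here the solution has its rows in the row space of
  Q.\<close>

lemma cramer_rule_low_rank_row:
  assumes P: "P \<in> carrier_mat n r" and Q: "Q \<in> carrier_mat r n" and det: "det (Q * P) \<noteq> 0"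
    and W: "W \<in> carrier_mat n r" and i: "i < n" and j: "j < n"
  shows "(W * Q) $$ (i, j) =
    (\<Sum>\<alpha>\<in>index_sets_at r n j. principal_minor (replace_row (P * Q) (row (W * Q * (P * Q)) i) j) \<alpha>) /
    (\<Sum>\<alpha>\<in>index_sets r n. principal_minor (P * Q) \<alpha>)"
proof -
  have PQ: "P * Q \<in> carrier_mat n n" and WQ: "W * Q \<in> carrier_mat n n" 
    and QP: "Q * P \<in> carrier_mat r r" using P Q W by auto
  have "det (P\<^sup>T * Q\<^sup>T) \<noteq> 0"
    using det det_transpose[OF QP] by (simp add: transpose_mult[OF Q P])
  then have "(Q\<^sup>T * W\<^sup>T) $$ (j, i) =
    (\<Sum>\<alpha>\<in>index_sets_at r n j. principal_minor (replace_col (Q\<^sup>T * P\<^sup>T) (col (Q\<^sup>T * P\<^sup>T * (Q\<^sup>T * W\<^sup>T)) i) j) \<alpha>) /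
    (\<Sum>\<alpha>\<in>index_sets r n. principal_minor (Q\<^sup>T * P\<^sup>T) \<alpha>)"
    using P Q W by (intro cramer_rule_low_rank_col i j) auto
  moreover have "principal_minor (replace_col (P * Q)\<^sup>T b j) \<alpha> = principal_minor (replace_row (P * Q) b j) \<alpha>" for b \<alpha>
  proof -
    have "replace_col (P * Q)\<^sup>T b j \<in> carrier_mat n n" using P Q by (auto simp: replace_col_def)
    from principal_minor_transpose[OF this] show ?thesis by (simp add: transpose_replace_col[OF PQ])
  qed
  moreover have "Q\<^sup>T * P\<^sup>T = (P * Q)\<^sup>T" "Q\<^sup>T * W\<^sup>T = (W * Q)\<^sup>T"
    using P Q W by (simp_all add: transpose_mult)
  moreover have "col ((P * Q)\<^sup>T * (W * Q)\<^sup>T) i = row (W * Q * (P * Q)) i"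
    using transpose_mult[OF WQ PQ] W Q P i by (metis WQ PQ carrier_matD(1) col_transpose index_mult_mat(2))
  ultimately show ?thesis
    using W Q i j by (simp add: principal_minor_transpose[OF PQ])
qed

subsection \<open>Adjoints and rank\<close>

lemma dim_mat_adjoint [simp]:
  "dim_row (mat_adjoint A) = dim_col A" "dim_col (mat_adjoint A) = dim_row A"
  by (simp_all add: mat_adjoint_def)

lemma index_mat_adjoint [simp]:
  "i < dim_col A \<Longrightarrow> j < dim_row A \<Longrightarrow> mat_adjoint A $$ (i, j) = conjugate (A $$ (j, i))"
  by (simp add: mat_adjoint_def mat_of_rows_def)

lemma mat_adjoint_carrier [simp]: "A \<in> carrier_mat m n \<Longrightarrow> mat_adjoint A \<in> carrier_mat n m"
  by auto

lemma mat_adjoint_adjoint [simp]: "mat_adjoint (mat_adjoint A) = (A :: complex mat)"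
  by (intro eq_matI) auto

lemma mat_adjoint_one [simp]: "mat_adjoint (1\<^sub>m n) = (1\<^sub>m n :: complex mat)"
  by (intro eq_matI) auto

lemma mat_adjoint_mult:
  "dim_col A = dim_row B \<Longrightarrow> mat_adjoint (A * B) = mat_adjoint B * mat_adjoint (A :: complex mat)"
  by (intro eq_matI) (auto simp: scalar_prod_def mult.commute intro!: sum.cong)

text \<open>Conditions on dimensions instead of carriers make this a rewrite rule that does not have
  to name the intermediate sizes; most regroupings of products below rest on it.\<close>

lemma mult_assoc_dim:
  "dim_col A = dim_row B \<Longrightarrow> dim_col B = dim_row C \<Longrightarrow> A * B * C = A * (B * (C :: 'a :: semiring_0 mat))"
  by (rule assoc_mult_mat[of A "dim_row A" "dim_col A" B "dim_col B" C "dim_col C"]) auto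

text \<open>The inner product of P v with itself equals that of P* P v with v, hence is zero;
  positive definiteness then gives P v = 0.\<close>

lemma mat_adjoint_mult_vec_eq_0:
  fixes P :: "complex mat"
  assumes P: "P \<in> carrier_mat n r" and v: "v \<in> carrier_vec r"
    and zero: "mat_adjoint P * P *\<^sub>v v = 0\<^sub>v r"
  shows "P *\<^sub>v v = 0\<^sub>v n"
proof -
  have Pv: "P *\<^sub>v v \<in> carrier_vec n" using P v by simp
  have "mat_adjoint P *\<^sub>v (P *\<^sub>v v) = 0\<^sub>v r"
    using v P zero by (subst assoc_mult_mat_vec[symmetric, of _ r n _ r]) auto
  \<comment> \<open>The transposition law for scalar products is bilinear, so the adjoint enters as
    the transpose acting on the conjugated vector.\<close>
  moreover have "P\<^sup>T *\<^sub>v conjugate (P *\<^sub>v v) = conjugate (mat_adjoint P *\<^sub>v (P *\<^sub>v v))"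
    using P v by (intro eq_vecI) (auto simp: scalar_prod_def intro!: sum.cong)
  ultimately have "(P *\<^sub>v v) \<bullet>c (P *\<^sub>v v) = 0"
    using transpose_vec_mult_scalar[OF P v, of "conjugate (P *\<^sub>v v)"] Pv v
    by (simp add: comm_scalar_prod[of _ n])
  then show ?thesis using conjugate_square_eq_0_vec[OF Pv] by simp
qed

text \<open>A kernel vector of the Gram matrix P* P is already killed by P.\<close>

lemma det_adjoint_mult_nonzero:
  fixes P :: "complex mat"
  assumes P: "P \<in> carrier_mat n r"
    and inj: "\<And>v. v \<in> carrier_vec r \<Longrightarrow> P *\<^sub>v v = 0\<^sub>v n \<Longrightarrow> v = 0\<^sub>v r"
  shows "det (mat_adjoint P * P) \<noteq> 0"
proof
  have PP: "mat_adjoint P * P \<in> carrier_mat r r" using P by auto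
  assume "det (mat_adjoint P * P) = 0"
  then obtain v where v: "v \<in> carrier_vec r" "v \<noteq> 0\<^sub>v r" "mat_adjoint P * P *\<^sub>v v = 0\<^sub>v r"
    unfolding det_0_iff_vec_prod_zero_field[OF PP] by blast
  show False using inj[OF v(1) mat_adjoint_mult_vec_eq_0[OF P v(1,3)]] v(2) by contradiction
qed

lemma det_adjoint_mult_nonzero_left_inverse:
  fixes P :: "complex mat"
  assumes P: "P \<in> carrier_mat n r" and L: "L \<in> carrier_mat r n" and LP: "L * P = 1\<^sub>m r"
  shows "det (mat_adjoint P * P) \<noteq> 0"
proof (rule det_adjoint_mult_nonzero[OF P])
  fix v assume v: "v \<in> carrier_vec r" "P *\<^sub>v v = 0\<^sub>v n"
  have "v = L *\<^sub>v (P *\<^sub>v v)"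
    using v(1) L P LP by (subst assoc_mult_mat_vec[symmetric, of _ r n _ r]) auto
  also have "\<dots> = 0\<^sub>v r" using v(2) L by (intro eq_vecI) auto
  finally show "v = 0\<^sub>v r" .
qed

lemma det_mult_adjoint_nonzero_right_inverse:
  fixes Q :: "complex mat"
  assumes Q: "Q \<in> carrier_mat r n" and K: "K \<in> carrier_mat n r" and QK: "Q * K = 1\<^sub>m r"
  shows "det (Q * mat_adjoint Q) \<noteq> 0"
  using det_adjoint_mult_nonzero_left_inverse[of "mat_adjoint Q" n r "mat_adjoint K"]
    mat_adjoint_mult[of Q K] assms
  by simp

section \<open>Full-rank factorizations\<close>

lemma det_nonzero_inverse:
  fixes A :: "'a :: field mat"
  assumes "A \<in> carrier_mat n n" "det A \<noteq> 0"
  obtains B where "B \<in> carrier_mat n n" "A * B = 1\<^sub>m n" "B * A = 1\<^sub>m n"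
  using det_non_zero_imp_unit[OF assms] by (auto simp: Units_def ring_mat_def)

lemma mat_eq_mult_if_cols:
  fixes B :: "'a :: semiring_0 mat"
  assumes B: "B \<in> carrier_mat n m" and P: "P \<in> carrier_mat n r"
    and cols: "\<And>j. j < m \<Longrightarrow> \<exists>v\<in>carrier_vec r. col B j = P *\<^sub>v v"
  obtains G where "G \<in> carrier_mat r m" "B = P * G"
proof -
  obtain g where g: "\<And>j. j < m \<Longrightarrow> g j \<in> carrier_vec r \<and> col B j = P *\<^sub>v g j"
    using cols by metis
  define G where "G = mat r m (\<lambda>(i, j). g j $ i)"
  have colG: "col G j = g j" if "j < m" for j using g[OF that] that by (auto simp: G_def)
  have "B = P * G"
  proof (rule mat_col_eqI)
    fix j assume "j < dim_col (P * G)"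
    then have j: "j < m" by (simp add: G_def)
    then show "col B j = col (P * G) j" using g[OF j] colG[OF j] col_mult2[OF P _ j, of G] by (simp add: G_def)
  qed (use B P in \<open>auto simp: G_def\<close>)
  then show ?thesis using that[of G] by (simp add: G_def)
qed

lemma (in vec_space) span_eq_range:
  assumes "P \<in> carrier_mat n r" "y \<in> span (set (cols P))"
  shows "\<exists>v\<in>carrier_vec r. y = P *\<^sub>v v"
  using assms col_space_eq[OF assms(1)] by (auto simp: col_space_def)

text \<open>P lists a maximal linearly independent set of columns of B, whose size is the rank.
  Maximality gives the spanning property, independence the trivial kernel.\<close>

lemma (in vec_space) rank_basis:
  assumes B: "B \<in> carrier_mat n m"
  obtains P where "P \<in> carrier_mat n (rank B)" "set (cols P) \<subseteq> set (cols B)"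
    "set (cols B) \<subseteq> span (set (cols P))" "\<And>v. v \<in> carrier_vec (rank B) \<Longrightarrow> P *\<^sub>v v = 0\<^sub>v n \<Longrightarrow> v = 0\<^sub>v (rank B)"
proof -
  let ?Q = "\<lambda>T. T \<subseteq> set (cols B) \<and> lin_indpt T"
  have "lin_indpt {}" by (simp add: lin_dep_def)
  then obtain S where S: "finite S" "maximal S ?Q"
    using maximal_exists_superset[of "set (cols B)" ?Q "{}"] by auto
  have SB: "S \<subseteq> set (cols B)" and ind: "lin_indpt S" using S(2) by (auto simp: maximal_def)
  have Bn: "set (cols B) \<subseteq> carrier_vec n" using B cols_dim by blast
  have rank: "rank B = card S" using rank_card_indpt[OF B S(2)] .
  obtain ss where ss: "set ss = S" "distinct ss" using finite_distinct_list[OF S(1)] by blast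
  define P where "P = mat_of_cols n ss"
  have cols: "cols P = ss" using ss SB Bn by (auto simp: P_def cols_mat_of_cols)
  have P: "P \<in> carrier_mat n (rank B)" using ss rank by (auto simp: P_def distinct_card)
  have "b \<in> span S" if b: "b \<in> set (cols B)" for b
  proof (rule ccontr)
    assume nb: "b \<notin> span S"
    have SV: "S \<subseteq> carrier_vec n" using SB Bn by blast
    then have "b \<notin> S" using nb span_mem by auto
    moreover have "lin_indpt (S \<union> {b})"
      using lin_dep_iff_in_span[OF _ ind, of b] nb SV b Bn \<open>b \<notin> S\<close> by auto
    ultimately show False using S(2) b SB unfolding maximal_def by (metis Un_insert_right Un_empty_right insertI1 insert_subset subset_insertI)
  qed
  moreover have "v = 0\<^sub>v (rank B)" if "v \<in> carrier_vec (rank B)" "P *\<^sub>v v = 0\<^sub>v n" for v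
    using lin_depI[OF P that(1) _ that(2)] ind ss cols by auto
  ultimately show ?thesis using that[OF P] ss cols SB by auto
qed

text \<open>A maximal independent set of columns of B gives P, and G holds the coordinates of the
  columns of B with respect to it. The one-sided inverses L and K express full rank in a form that
  cancels inside products.\<close>

lemma rank_factorization:
  assumes B: "B \<in> carrier_mat n m" and r: "mat_rank B = r"
  obtains P G L K where
    "P \<in> carrier_mat n r" "G \<in> carrier_mat r m" "L \<in> carrier_mat r n" "K \<in> carrier_mat m r"
    "B = P * G" "L * P = 1\<^sub>m r" "G * K = 1\<^sub>m r"
proof -
  interpret vec_space "TYPE(complex)" n .
  have r: "rank B = r" using r B by (simp add: mat_rank_def)
  obtain P where P: "P \<in> carrier_mat n r" and sub: "set (cols P) \<subseteq> set (cols B)"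
    and span: "set (cols B) \<subseteq> span (set (cols P))"
    and ker: "\<And>v. v \<in> carrier_vec r \<Longrightarrow> P *\<^sub>v v = 0\<^sub>v n \<Longrightarrow> v = 0\<^sub>v r"
    using rank_basis[OF B] unfolding r by blast
  have colin: "col C j \<in> set (cols C)" if "j < dim_col C" for C :: "complex mat" and j
    using that by (metis cols_length cols_nth nth_mem)
  have "\<exists>v\<in>carrier_vec r. col B j = P *\<^sub>v v" if "j < m" for j
    using span_eq_range[OF P] span colin[of j B] that B by auto
  then obtain G where G: "G \<in> carrier_mat r m" "B = P * G"
    using mat_eq_mult_if_cols[OF B P] by blast
  \<comment> \<open>The columns of P are columns of B, so P = B K for some K; this K turns out to be
    a right inverse of G.\<close>
  have "\<exists>v\<in>carrier_vec m. col P j = B *\<^sub>v v" if "j < r" for j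
    using span_eq_range[OF B] in_own_span[of "set (cols B)"] sub colin[of j P] that P B cols_dim[of B] by auto
  then obtain K where K: "K \<in> carrier_mat m r" "P = B * K"
    using mat_eq_mult_if_cols[OF P B] by blast
  have PP: "mat_adjoint P * P \<in> carrier_mat r r" using P by auto
  have "det (mat_adjoint P * P) \<noteq> 0" using det_adjoint_mult_nonzero[OF P ker] .
  then obtain H where H: "H \<in> carrier_mat r r" "H * (mat_adjoint P * P) = 1\<^sub>m r"
    using det_nonzero_inverse[OF PP] by metis
  \<comment> \<open>With H the inverse of the Gram matrix P* P, this is the usual pseudoinverse of
    an injective P.\<close>
  define L where "L = H * mat_adjoint P"
  have L: "L \<in> carrier_mat r n" "L * P = 1\<^sub>m r"
    using H P by (auto simp: L_def mult_assoc_dim)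
  \<comment> \<open>Since P G K = B K = P, multiplying by L on the left cancels P.\<close>
  have "P * G * K = P" by (simp only: G(2)[symmetric] K(2)[symmetric])
  then have "1\<^sub>m r = L * (P * G * K)" by (simp only: L(2))
  also have "\<dots> = L * P * (G * K)" using L(1) P G(1) K(1) by (simp add: mult_assoc_dim)
  finally have "G * K = 1\<^sub>m r" using L(2) G(1) K(1) by simp
  then show ?thesis using that P G L K by blast
qed

text \<open>If the rank r exceeded b, sandwiching U V between L and K would write the r by r
  identity as a product with inner dimension b < r, whose determinant is zero.\<close>

lemma mat_rank_mult_le_inner:
  assumes U: "U \<in> carrier_mat n b" and V: "V \<in> carrier_mat b m"
  shows "mat_rank (U * V) \<le> b"
proof (rule ccontr)
  define r where "r = mat_rank (U * V)"
  assume "\<not> mat_rank (U * V) \<le> b"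
  then have br: "b < r" by (simp add: r_def)
  have UV: "U * V \<in> carrier_mat n m" using U V by simp
  obtain P G L K where f: "P \<in> carrier_mat n r" "G \<in> carrier_mat r m" "L \<in> carrier_mat r n" "K \<in> carrier_mat m r"
    "U * V = P * G" "L * P = 1\<^sub>m r" "G * K = 1\<^sub>m r"
    using rank_factorization[OF UV r_def[symmetric]] by blast
  have "(L * U) * (V * K) = L * (U * V) * K" using U V f(1-4) by (simp add: mult_assoc_dim)
  also have "\<dots> = L * (P * G) * K" using f(5) by simp
  also have "\<dots> = (L * P) * (G * K)" using f(1-4) by (simp add: mult_assoc_dim)
  also have "\<dots> = 1\<^sub>m r" using f by simp
  finally show False
    using det_mult_zero_if_inner_dim_less[of "L * U" r b "V * K", OF _ _ br] U V f by simp
qed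

text \<open>A full-rank factorization of A makes A B factor through dimension rk A.\<close>

lemma mat_rank_mult_le:
  assumes A: "A \<in> carrier_mat n m" and B: "B \<in> carrier_mat m l"
  shows "mat_rank (A * B) \<le> mat_rank A"
proof -
  obtain P G L K where f: "P \<in> carrier_mat n (mat_rank A)" "G \<in> carrier_mat (mat_rank A) m" "A = P * G"
    using rank_factorization[OF A refl] by metis
  then show ?thesis
    using mat_rank_mult_le_inner[OF f(1), of "G * B" l] B by (simp add: mult_assoc_dim)
qed

text \<open>For a full-rank factorization A = P Q, equality of the ranks forces Q P to be
  invertible. Its inverse then exhibits A as both a right and a left multiple of its square.\<close>

lemma mat_rank_square_factors:
  assumes A: "A \<in> carrier_mat n n" and rank: "mat_rank (A * A) = mat_rank A"
  obtains G H where "G \<in> carrier_mat n n" "H \<in> carrier_mat n n" "A = A * A * G" "A = H * A * A"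
proof -
  let ?r = "mat_rank A"
  obtain P Q L K where f: "P \<in> carrier_mat n ?r" "Q \<in> carrier_mat ?r n" "L \<in> carrier_mat ?r n" "K \<in> carrier_mat n ?r"
    "A = P * Q" "L * P = 1\<^sub>m ?r" "Q * K = 1\<^sub>m ?r"
    using rank_factorization[OF A refl] by blast
  have AA: "A * A \<in> carrier_mat n n" using A by simp
  obtain P' Q' L' K' where f': "P' \<in> carrier_mat n ?r" "Q' \<in> carrier_mat ?r n" "L' \<in> carrier_mat ?r n" "K' \<in> carrier_mat n ?r"
    "A * A = P' * Q'" "L' * P' = 1\<^sub>m ?r" "Q' * K' = 1\<^sub>m ?r"
    using rank_factorization[OF AA rank] by blast
  have d: "dim_row P = n" "dim_col P = ?r" "dim_row Q = ?r" "dim_col Q = n"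
      "dim_row L = ?r" "dim_col L = n" "dim_row K = n" "dim_col K = ?r"
      "dim_row P' = n" "dim_col P' = ?r" "dim_row Q' = ?r" "dim_col Q' = n"
      "dim_row L' = ?r" "dim_col L' = n" "dim_row K' = n" "dim_col K' = ?r"
    using f(1-4) f'(1-4) by auto
  \<comment> \<open>The product L' A A K' is the identity, while A A = P Q P Q; so det(Q P) is a
    factor of 1 and cannot vanish.\<close>
  have "(L' * P) * ((Q * P) * (Q * K')) = L' * ((P * Q) * (P * Q)) * K'" using d by (simp add: mult_assoc_dim)
  also have "\<dots> = L' * (P' * Q') * K'" using f(5) f'(5) by metis
  also have "\<dots> = (L' * P') * (Q' * K')" using d by (simp add: mult_assoc_dim)
  also have "\<dots> = 1\<^sub>m ?r" using f' by simp
  finally have one: "(L' * P) * ((Q * P) * (Q * K')) = 1\<^sub>m ?r" .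
  have c: "L' * P \<in> carrier_mat ?r ?r" "Q * P \<in> carrier_mat ?r ?r" "Q * K' \<in> carrier_mat ?r ?r"
    using f f' by auto
  have "det (L' * P) * (det (Q * P) * det (Q * K')) = 1"
    using arg_cong[OF one, of det] det_mult[OF c(2,3)] det_mult[OF c(1), of "Q * P * (Q * K')"] c by simp
  then have "det (Q * P) \<noteq> 0" by auto
  then obtain W where W: "W \<in> carrier_mat ?r ?r" "Q * P * W = 1\<^sub>m ?r" "W * (Q * P) = 1\<^sub>m ?r"
    using det_nonzero_inverse[OF c(2)] by metis
  have dW: "dim_row W = ?r" "dim_col W = ?r" using W by auto
  \<comment> \<open>The multipliers \<open>K * W * Q\<close> and \<open>P * W * L\<close> work
    because W inverts Q P while Q K = 1 and L P = 1.\<close>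
  have "A * A * (K * W * Q) = P * (Q * P * (Q * K * W)) * Q"
    unfolding f(5) using d dW by (simp add: mult_assoc_dim)
  also have "\<dots> = A" using f W by simp
  finally have G: "A = A * A * (K * W * Q)" by simp
  have "(P * W * L) * A * A = P * (W * (L * P * (Q * P))) * Q"
    unfolding f(5) using d dW by (simp add: mult_assoc_dim)
  also have "\<dots> = A" using f W c by simp
  finally have H: "A = (P * W * L) * A * A" by simp
  show ?thesis using that[OF _ _ G H] f W by simp
qed

subsection \<open>Generalized inverses\<close>

text \<open>With B = P G of full rank, B B* is the n by r matrix P G G* times P*. The row version of
  Cramer's rule applies: X = Z G* P* has its rows in the row space of P*, X B B* = C B*, and both P*
  P and G G* have nonzero determinant.\<close>

lemma determinantal_representation_row:
  assumes B: "B \<in> carrier_mat n n" and rank: "mat_rank B = r"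
    and Z: "Z \<in> carrier_mat n n" and X: "X = Z * mat_adjoint B" and XB: "X * B = C"
    and i: "i < n" and j: "j < n"
  shows "X $$ (i, j) =
    (\<Sum>\<alpha>\<in>index_sets_at r n j.
      principal_minor (replace_row (B * mat_adjoint B) (row (C * mat_adjoint B) i) j) \<alpha>) /
    (\<Sum>\<alpha>\<in>index_sets r n. principal_minor (B * mat_adjoint B) \<alpha>)"
proof -
  obtain P G L K where f: "P \<in> carrier_mat n r" "G \<in> carrier_mat r n" "L \<in> carrier_mat r n" "K \<in> carrier_mat n r"
    "B = P * G" "L * P = 1\<^sub>m r" "G * K = 1\<^sub>m r"
    using rank_factorization[OF B rank] by blast
  have d: "dim_row P = n" "dim_col P = r" "dim_row G = r" "dim_col G = n" "dim_row Z = n" "dim_col Z = n"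
    using f(1,2) Z by auto
  have adj: "mat_adjoint B = mat_adjoint G * mat_adjoint P"
    using f(5) d by (simp add: mat_adjoint_mult)
  have BB: "B * mat_adjoint B = P * (G * mat_adjoint G) * mat_adjoint P"
    unfolding adj unfolding f(5) using d by (simp add: mult_assoc_dim)
  have X': "X = Z * mat_adjoint G * mat_adjoint P"
    unfolding X adj using d by (simp add: mult_assoc_dim)
  have XBB: "X * (B * mat_adjoint B) = C * mat_adjoint B"
    using B Z unfolding XB[symmetric] X by (simp add: mult_assoc_dim)
  have c: "mat_adjoint P * P \<in> carrier_mat r r" "G * mat_adjoint G \<in> carrier_mat r r"
    using f(1,2) by auto
  have "mat_adjoint P * (P * (G * mat_adjoint G)) = mat_adjoint P * P * (G * mat_adjoint G)"
    using d by (simp add: mult_assoc_dim)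
  then have "det (mat_adjoint P * (P * (G * mat_adjoint G))) \<noteq> 0"
    using det_mult[OF c] det_adjoint_mult_nonzero_left_inverse[OF f(1,3,6)]
      det_mult_adjoint_nonzero_right_inverse[OF f(2,4,7)] by simp
  moreover have "P * (G * mat_adjoint G) \<in> carrier_mat n r" "Z * mat_adjoint G \<in> carrier_mat n r"
    using d by (auto intro!: carrier_matI)
  ultimately show ?thesis
    using cramer_rule_low_rank_row[OF _ mat_adjoint_carrier[OF f(1)] _ _ i j, of "P * (G * mat_adjoint G)" "Z * mat_adjoint G"]
    unfolding BB[symmetric] X'[symmetric] XBB by blast
qed

text \<open>Mirror image of the row version: B* B is G* times P* P G, the columns of Y lie in the
  column space of G*, and B* B Y = B* C.\<close>

lemma determinantal_representation_col:
  assumes B: "B \<in> carrier_mat n n" and rank: "mat_rank B = r"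
    and Z: "Z \<in> carrier_mat n n" and Y: "Y = mat_adjoint B * Z" and BY: "B * Y = C"
    and i: "i < n" and j: "j < n"
  shows "Y $$ (i, j) =
    (\<Sum>\<beta>\<in>index_sets_at r n i.
      principal_minor (replace_col (mat_adjoint B * B) (col (mat_adjoint B * C) j) i) \<beta>) /
    (\<Sum>\<beta>\<in>index_sets r n. principal_minor (mat_adjoint B * B) \<beta>)"
proof -
  obtain P G L K where f: "P \<in> carrier_mat n r" "G \<in> carrier_mat r n" "L \<in> carrier_mat r n" "K \<in> carrier_mat n r"
    "B = P * G" "L * P = 1\<^sub>m r" "G * K = 1\<^sub>m r"
    using rank_factorization[OF B rank] by blast
  have d: "dim_row P = n" "dim_col P = r" "dim_row G = r" "dim_col G = n" "dim_row Z = n" "dim_col Z = n"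
    using f(1,2) Z by auto
  have adj: "mat_adjoint B = mat_adjoint G * mat_adjoint P"
    using f(5) d by (simp add: mat_adjoint_mult)
  have BB: "mat_adjoint B * B = mat_adjoint G * (mat_adjoint P * P * G)"
    unfolding adj unfolding f(5) using d by (simp add: mult_assoc_dim)
  have Y': "Y = mat_adjoint G * (mat_adjoint P * Z)"
    unfolding Y adj using d by (simp add: mult_assoc_dim)
  have BBY: "mat_adjoint B * B * Y = mat_adjoint B * C"
    using B Z unfolding BY[symmetric] Y by (simp add: mult_assoc_dim)
  have c: "mat_adjoint P * P \<in> carrier_mat r r" "G * mat_adjoint G \<in> carrier_mat r r"
    using f(1,2) by auto
  have "mat_adjoint P * P * G * mat_adjoint G = mat_adjoint P * P * (G * mat_adjoint G)"
    using d by (simp add: mult_assoc_dim)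
  then have "det (mat_adjoint P * P * G * mat_adjoint G) \<noteq> 0"
    using det_mult[OF c] det_adjoint_mult_nonzero_left_inverse[OF f(1,3,6)]
      det_mult_adjoint_nonzero_right_inverse[OF f(2,4,7)] by simp
  moreover have "mat_adjoint P * P * G \<in> carrier_mat r n" "mat_adjoint P * Z \<in> carrier_mat r n"
    using d by (auto intro!: carrier_matI)
  ultimately show ?thesis
    using cramer_rule_low_rank_col[OF mat_adjoint_carrier[OF f(2)] _ _ _ i j, of "mat_adjoint P * P * G" "mat_adjoint P * Z"]
    unfolding BB[symmetric] Y'[symmetric] BBY by blast
qed

text \<open>Testing the inclusion on unit vectors shows that every column of X is D times a vector;
  these vectors form V. Range conditions thereby become matrix identities.\<close>

lemma right_range_subset_factor:
  assumes X: "X \<in> carrier_mat n m" and D: "D \<in> carrier_mat n l"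
    and sub: "right_range X \<subseteq> right_range D"
  obtains V where "V \<in> carrier_mat l m" "X = D * V"
proof (rule mat_eq_mult_if_cols[OF X D])
  fix j assume j: "j < m"
  \<comment> \<open>The j-th unit vector as an m by 1 matrix, since ranges consist of one-column
    matrices.\<close>
  define e where "e = mat m 1 (\<lambda>(i, k). if i = j then 1 else 0 :: complex)"
  have e: "e \<in> carrier_mat m 1" by (simp add: e_def)
  have "col e 0 = unit_vec m j" using j by (intro eq_vecI) (auto simp: e_def unit_vec_def)
  then have "col (X * e) 0 = col X j"
    using col_mult2[OF X e, of 0] X j by (auto intro!: eq_vecI)
  moreover have "X * e \<in> right_range D" using sub e X unfolding right_range_def by blast
  then obtain x where x: "x \<in> carrier_mat l 1" "X * e = D * x" using D by (auto simp: right_range_def)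
  moreover have "col (D * x) 0 = D *\<^sub>v col x 0" using col_mult2[OF D x(1)] by simp
  ultimately show "\<exists>v\<in>carrier_vec l. col X j = D *\<^sub>v v" by (intro bexI[of _ "col x 0"]) auto
qed (rule that)

text \<open>Bridge between the two kinds of range, by which the factorization on the left follows
  from the one on the right.\<close>

lemma right_range_transpose:
  "right_range A\<^sup>T = transpose_mat ` left_range A"
proof -
  have 1: "(y * A)\<^sup>T = A\<^sup>T * y\<^sup>T" if "y \<in> carrier_mat 1 (dim_row A)" for y
    using that by (simp add: transpose_mult[of _ 1 "dim_row A" _ "dim_col A"])
  show ?thesis
  proof (intro equalityI subsetI)
    fix z assume "z \<in> right_range A\<^sup>T"
    then obtain x where x: "x \<in> carrier_mat (dim_row A) 1" "z = A\<^sup>T * x"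
      by (auto simp: right_range_def)
    then have "x\<^sup>T \<in> carrier_mat 1 (dim_row A)" by simp
    with 1[OF this] x show "z \<in> transpose_mat ` left_range A"
      unfolding left_range_def by (intro image_eqI[of _ _ "x\<^sup>T * A"]) auto
  next
    fix z assume "z \<in> transpose_mat ` left_range A"
    then obtain y where y: "y \<in> carrier_mat 1 (dim_row A)" "z = (y * A)\<^sup>T"
      by (auto simp: left_range_def)
    then have "z = A\<^sup>T * y\<^sup>T" "y\<^sup>T \<in> carrier_mat (dim_col A\<^sup>T) 1" using 1 by simp_all
    then show "z \<in> right_range A\<^sup>T" unfolding right_range_def by blast
  qed
qed

lemma left_range_subset_factor:
  assumes X: "X \<in> carrier_mat m n" and D: "D \<in> carrier_mat l n"
    and sub: "left_range X \<subseteq> left_range D"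
  obtains V where "V \<in> carrier_mat m l" "X = V * D"
proof -
  have "right_range X\<^sup>T \<subseteq> right_range D\<^sup>T" using sub by (auto simp: right_range_transpose)
  then obtain V where V: "V \<in> carrier_mat l m" "X\<^sup>T = D\<^sup>T * V"
    using right_range_subset_factor[of "X\<^sup>T" n m "D\<^sup>T" l] X D by auto
  then have "X = V\<^sup>T * D" using D by (metis transpose_mult transpose_carrier_mat transpose_transpose)
  then show ?thesis using that[of "V\<^sup>T"] V by simp
qed

section \<open>Powers, the Drazin inverse and core EP inverses\<close>

lemma pow_mat_Suc_left:
  assumes A: "A \<in> carrier_mat n n"
  shows "A ^\<^sub>m Suc k = A * A ^\<^sub>m k"
proof (induct k)
  case 0 then show ?case using A by simp
next
  case (Suc k)
  have "A ^\<^sub>m Suc (Suc k) = A * A ^\<^sub>m k * A" using Suc by simp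
  also have "\<dots> = A * A ^\<^sub>m Suc k"
    using A by (simp add: assoc_mult_mat[of _ n n _ n _ n])
  finally show ?case .
qed

text \<open>Commutation turns D = D A D into D = A D D = D D A. Substituting a known factorization
  for one factor D raises the exponent by one.\<close>

lemma drazin_inverse_eq_pow_mult:
  assumes A: "A \<in> carrier_mat n n" and D: "D \<in> carrier_mat n n"
    and DAD: "D * A * D = D" and comm: "A * D = D * A"
  shows "\<exists>E\<in>carrier_mat n n. D = A ^\<^sub>m m * E" "\<exists>E\<in>carrier_mat n n. D = E * A ^\<^sub>m m"
proof -
  have p: "A ^\<^sub>m k \<in> carrier_mat n n" for k using A by simp
  note dims = carrier_matD[OF A] carrier_matD[OF D] carrier_matD[OF p]
  have D1: "D = A * D * D" using DAD comm by simp
  have D2: "D = D * D * A" using DAD comm dims by (simp add: mult_assoc_dim)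
  show "\<exists>E\<in>carrier_mat n n. D = A ^\<^sub>m m * E"
  proof (induct m)
    case 0 then show ?case using A D by (intro bexI[of _ D]) auto
  next
    case (Suc m)
    then obtain E where E: "E \<in> carrier_mat n n" "D = A ^\<^sub>m m * E" by blast
    note D1
    also have "A * D * D = A * (A ^\<^sub>m m * E) * D" using E(2) by simp
    also have "\<dots> = A ^\<^sub>m Suc m * (E * D)"
      unfolding pow_mat_Suc_left[OF A] using dims carrier_matD[OF E(1)] by (simp add: mult_assoc_dim)
    finally show ?case using E(1) D by (intro bexI[of _ "E * D"]) auto
  qed
  show "\<exists>E\<in>carrier_mat n n. D = E * A ^\<^sub>m m"
  proof (induct m)
    case 0 then show ?case using A D by (intro bexI[of _ D]) auto
  next
    case (Suc m)
    then obtain E where E: "E \<in> carrier_mat n n" "D = E * A ^\<^sub>m m" by blast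
    note D2
    also have "D * D * A = D * (E * A ^\<^sub>m m) * A" using E(2) by simp
    also have "\<dots> = (D * E) * A ^\<^sub>m Suc m"
      using dims carrier_matD[OF E(1)] by (simp add: mult_assoc_dim)
    finally show ?case using E(1) D by (intro bexI[of _ "D * E"]) auto
  qed
qed

text \<open>The minimum defining the index exists: ranks of successive powers never increase, and a
  strict decrease at every step would push them below zero.\<close>

lemma mat_rank_pow_index:
  assumes A: "A \<in> carrier_mat n n"
  shows "mat_rank (A ^\<^sub>m (mat_index A + 1)) = mat_rank (A ^\<^sub>m mat_index A)"
  unfolding mat_index_def
proof (rule LeastI_ex, rule ccontr)
  let ?f = "\<lambda>k. mat_rank (A ^\<^sub>m k)"
  assume "\<nexists>k. ?f (k + 1) = ?f k"
  moreover have "?f (k + 1) \<le> ?f k" for k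
    using mat_rank_mult_le[OF pow_carrier_mat[OF A, of k] A] by simp
  ultimately have less: "?f (Suc k) < ?f k" for k
    by (metis Suc_eq_plus1 le_neq_implies_less)
  have "?f k + k \<le> ?f 0" for k
  proof (induct k)
    case (Suc k) then show ?case using less[of k] by linarith
  qed simp
  from this[of "Suc (?f 0)"] show False by simp
qed

lemma pow_mat_commute:
  assumes A: "A \<in> carrier_mat n n" and D: "D \<in> carrier_mat n n" and comm: "A * D = D * A"
  shows "A ^\<^sub>m k * D = D * A ^\<^sub>m k"
proof (induct k)
  case 0 then show ?case using A D by simp
next
  case (Suc k)
  note dims = carrier_matD[OF A] carrier_matD[OF D] carrier_matD[OF pow_carrier_mat[OF A, of k]]
  have "A ^\<^sub>m Suc k * D = A ^\<^sub>m k * (A * D)" using dims by (simp add: mult_assoc_dim)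
  also have "\<dots> = (A ^\<^sub>m k * D) * A" unfolding comm using dims by (simp add: mult_assoc_dim)
  also have "\<dots> = D * A ^\<^sub>m Suc k" unfolding Suc using dims by (simp add: mult_assoc_dim)
  finally show ?case .
qed

text \<open>Write B = A^(k+1). The range of D lies in that of X, so D = X V and A^k = D B is X times
  V B; now X A X = X yields X B = X A A^k = A^k. The range of X* lies in that of D, so X* = D W = B
  E W, and taking adjoints gives X the right factor B*.\<close>

lemma right_core_EP_inverse_pow:
  assumes A: "A \<in> carrier_mat n n" and X: "is_right_core_EP_inverse A X"
  shows "X * A ^\<^sub>m (mat_index A + 1) = A ^\<^sub>m mat_index A"
    and "\<exists>Z\<in>carrier_mat n n. X = Z * mat_adjoint (A ^\<^sub>m (mat_index A + 1))"
proof -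
  let ?k = "mat_index A"
  let ?B = "A ^\<^sub>m (?k + 1)"
  obtain D where Xc: "X \<in> carrier_mat n n" and XAX: "X * A * X = X" and Dr: "is_drazin_inverse A D"
    and r1: "right_range D \<subseteq> right_range X" and r2: "right_range (mat_adjoint X) \<subseteq> right_range D"
    using X A unfolding is_right_core_EP_inverse_def by auto
  then have D: "D \<in> carrier_mat n n" "D * A * D = D" "A * D = D * A" "D * ?B = A ^\<^sub>m ?k"
    using A unfolding is_drazin_inverse_def by auto
  have pc: "A ^\<^sub>m k \<in> carrier_mat n n" for k using A by simp
  obtain V where V: "V \<in> carrier_mat n n" "D = X * V"
    using right_range_subset_factor[OF D(1) Xc r1] .
  obtain W where W: "W \<in> carrier_mat n n" "mat_adjoint X = D * W"
    using right_range_subset_factor[OF mat_adjoint_carrier[OF Xc] D(1) r2] .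
  \<comment> \<open>The exponent k + 1 is chosen so that the power is B itself.\<close>
  obtain E where E: "E \<in> carrier_mat n n" "D = ?B * E"
    using drazin_inverse_eq_pow_mult(1)[OF A D(1-3)] by blast
  note dims = carrier_matD[OF A] carrier_matD[OF Xc] carrier_matD[OF V(1)] carrier_matD[OF W(1)]
    carrier_matD[OF E(1)] carrier_matD[OF pc[of "?k + 1"]] carrier_matD[OF pc[of ?k]]
  have "A ^\<^sub>m ?k = X * V * ?B" by (simp only: V(2)[symmetric] D(4))
  also have "\<dots> = X * (V * ?B)" using dims by (simp only: mult_assoc_dim)
  finally have Q: "A ^\<^sub>m ?k = X * (V * ?B)" .
  have "X * ?B = X * (A * A ^\<^sub>m ?k)" using pow_mat_Suc_left[OF A, of ?k] by simp
  also have "\<dots> = X * (A * (X * (V * ?B)))" by (simp only: Q[symmetric])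
  also have "\<dots> = X * A * X * (V * ?B)" using dims by (simp only: mult_assoc_dim index_mult_mat)
  also have "\<dots> = A ^\<^sub>m ?k" by (simp only: XAX Q[symmetric])
  finally show "X * ?B = A ^\<^sub>m ?k" .
  have "mat_adjoint X = ?B * E * W" by (simp only: W(2) E(2)[symmetric])
  then have "X = mat_adjoint (?B * E * W)" by (metis mat_adjoint_adjoint)
  also have "\<dots> = mat_adjoint (E * W) * mat_adjoint ?B"
    using dims by (simp only: mult_assoc_dim mat_adjoint_mult index_mult_mat)
  finally show "\<exists>Z\<in>carrier_mat n n. X = Z * mat_adjoint ?B"
    using dims by (intro bexI[of _ "mat_adjoint (E * W)"] carrier_matI) simp_all
qed

text \<open>Dual argument with row spaces: D = V Y makes A^k end in Y, and Y A Y = Y absorbs the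
  extra factor A Y. From Y* = W D = W E B the adjoint gives Y the left factor B*.\<close>

lemma left_core_EP_inverse_pow:
  assumes A: "A \<in> carrier_mat n n" and Y: "is_left_core_EP_inverse A Y"
  shows "A ^\<^sub>m (mat_index A + 1) * Y = A ^\<^sub>m mat_index A"
    and "\<exists>Z\<in>carrier_mat n n. Y = mat_adjoint (A ^\<^sub>m (mat_index A + 1)) * Z"
proof -
  let ?k = "mat_index A"
  let ?B = "A ^\<^sub>m (?k + 1)"
  obtain D where Yc: "Y \<in> carrier_mat n n" and YAY: "Y * A * Y = Y" and Dr: "is_drazin_inverse A D"
    and r1: "left_range D \<subseteq> left_range Y" and r2: "left_range (mat_adjoint Y) \<subseteq> left_range D"
    using Y A unfolding is_left_core_EP_inverse_def by auto
  then have D: "D \<in> carrier_mat n n" "D * A * D = D" "A * D = D * A" "D * ?B = A ^\<^sub>m ?k"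
    using A unfolding is_drazin_inverse_def by auto
  have pc: "A ^\<^sub>m k \<in> carrier_mat n n" for k using A by simp
  obtain V where V: "V \<in> carrier_mat n n" "D = V * Y"
    using left_range_subset_factor[OF D(1) Yc r1] .
  obtain W where W: "W \<in> carrier_mat n n" "mat_adjoint Y = W * D"
    using left_range_subset_factor[OF mat_adjoint_carrier[OF Yc] D(1) r2] .
  obtain E where E: "E \<in> carrier_mat n n" "D = E * ?B"
    using drazin_inverse_eq_pow_mult(2)[OF A D(1-3)] by blast
  note dims = carrier_matD[OF A] carrier_matD[OF Yc] carrier_matD[OF V(1)] carrier_matD[OF W(1)]
    carrier_matD[OF E(1)] carrier_matD[OF pc[of "?k + 1"]] carrier_matD[OF pc[of ?k]]
  \<comment> \<open>D commutes with powers of A, so D B = A^k also reads B D = A^k, which places Y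
    at the right end.\<close>
  have "A ^\<^sub>m ?k = ?B * (V * Y)"
    by (simp only: V(2)[symmetric] pow_mat_commute[OF A D(1,3)] D(4))
  also have "\<dots> = ?B * V * Y" using dims by (simp only: mult_assoc_dim)
  finally have Q: "A ^\<^sub>m ?k = ?B * V * Y" .
  have "?B * Y = A ^\<^sub>m ?k * A * Y" by simp
  also have "\<dots> = ?B * V * Y * A * Y" by (simp only: Q[symmetric])
  also have "\<dots> = ?B * V * (Y * A * Y)" using dims by (simp only: mult_assoc_dim index_mult_mat)
  also have "\<dots> = A ^\<^sub>m ?k" by (simp only: YAY Q[symmetric])
  finally show "?B * Y = A ^\<^sub>m ?k" .
  have "mat_adjoint Y = W * (E * ?B)" by (simp only: W(2) E(2)[symmetric])
  then have "Y = mat_adjoint (W * (E * ?B))" by (metis mat_adjoint_adjoint)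
  also have "\<dots> = mat_adjoint ?B * mat_adjoint (W * E)"
    using dims by (simp only: mult_assoc_dim[symmetric] mat_adjoint_mult index_mult_mat)
  finally show "\<exists>Z\<in>carrier_mat n n. Y = mat_adjoint ?B * Z"
    using dims by (intro bexI[of _ "mat_adjoint (W * E)"] carrier_matI) simp_all
qed

section \<open>Core inverses at index 1\<close>

lemma pow_mat_2:
  assumes "A \<in> carrier_mat n n"
  shows "A ^\<^sub>m 2 = A * A"
  using assms by (simp add: numeral_2_eq_2)

lemma mat_rank_square_if_index_1:
  assumes A: "A \<in> carrier_mat n n" and "mat_index A = 1"
  shows "mat_rank (A * A) = mat_rank A"
  using mat_rank_pow_index[OF A] assms pow_mat_2[OF A] by (simp add: numeral_2_eq_2)

text \<open>At index 1, A = H A A = A A G. Since X = A U, it follows that X = H A A U = H A X = H A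
  P, so X A A = H A P A A = H A A = A. As A P is self-adjoint and equals A A G P, it has the adjoint
  of A A as right factor, and so has X.\<close>

lemma right_core_inverse_square:
  assumes A: "A \<in> carrier_mat n n" and index: "mat_index A = 1" and X: "is_right_core_inverse A X"
  shows "X * (A * A) = A" and "\<exists>Z\<in>carrier_mat n n. X = Z * mat_adjoint (A * A)"
proof -
  obtain P where Xc: "X \<in> carrier_mat n n" and P: "P \<in> carrier_mat n n" and APA: "A * P * A = A"
    and AP: "mat_adjoint (A * P) = A * P" and AX: "A * X = A * P"
    and sub: "right_range X \<subseteq> right_range A"
    using X A unfolding is_right_core_inverse_def is_moore_penrose_inverse_def by auto
  obtain U where U: "U \<in> carrier_mat n n" "X = A * U"
    using right_range_subset_factor[OF Xc A sub] .
  obtain G H where G: "G \<in> carrier_mat n n" "A = A * A * G" and H: "H \<in> carrier_mat n n" "A = H * A * A"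
    using mat_rank_square_factors[OF A mat_rank_square_if_index_1[OF A index]] by blast
  note dims = carrier_matD[OF A] carrier_matD[OF P] carrier_matD[OF U(1)] carrier_matD[OF G(1)]
    carrier_matD[OF H(1)] carrier_matD[OF Xc]
  have "X = H * A * A * U" by (simp only: H(2)[symmetric] U(2)[symmetric])
  also have "\<dots> = H * (A * X)" unfolding U(2) using dims by (simp only: mult_assoc_dim index_mult_mat)
  finally have XHAP: "X = H * (A * P)" unfolding AX .
  then have "X * (A * A) = H * (A * P) * (A * A)" by simp
  also have "\<dots> = H * (A * P * A) * A" using dims by (simp only: mult_assoc_dim index_mult_mat)
  finally show "X * (A * A) = A" unfolding APA H(2)[symmetric] .
  have "A * P = mat_adjoint (A * A * G * P)" by (simp only: G(2)[symmetric] AP)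
  also have "\<dots> = mat_adjoint (G * P) * mat_adjoint (A * A)"
    using dims by (simp only: mult_assoc_dim[of "A * A" G P] mat_adjoint_mult[of "A * A" "G * P"] index_mult_mat)
  finally have AP': "A * P = mat_adjoint (G * P) * mat_adjoint (A * A)" .
  have "X = H * (mat_adjoint (G * P) * mat_adjoint (A * A))" by (simp only: XHAP AP')
  also have "\<dots> = (H * mat_adjoint (G * P)) * mat_adjoint (A * A)"
    using dims by (simp only: mult_assoc_dim index_mult_mat dim_mat_adjoint)
  finally show "\<exists>Z\<in>carrier_mat n n. X = Z * mat_adjoint (A * A)"
    using dims by (intro bexI[of _ "H * mat_adjoint (G * P)"] carrier_matI) simp_all
qed

text \<open>Here Y = U A = U A A G = Y A G = P A G, so A A Y = A A P A G = A A G = A. As P A is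
  self-adjoint and equals P H A A, it has the adjoint of A A as left factor, and so has Y.\<close>

lemma left_core_inverse_square:
  assumes A: "A \<in> carrier_mat n n" and index: "mat_index A = 1" and Y: "is_left_core_inverse A Y"
  shows "A * A * Y = A" and "\<exists>Z\<in>carrier_mat n n. Y = mat_adjoint (A * A) * Z"
proof -
  obtain P where Yc: "Y \<in> carrier_mat n n" and P: "P \<in> carrier_mat n n" and APA: "A * P * A = A"
    and PA: "mat_adjoint (P * A) = P * A" and YA: "Y * A = P * A"
    and sub: "left_range Y \<subseteq> left_range A"
    using Y A unfolding is_left_core_inverse_def is_moore_penrose_inverse_def by auto
  obtain U where U: "U \<in> carrier_mat n n" "Y = U * A"
    using left_range_subset_factor[OF Yc A sub] .
  obtain G H where G: "G \<in> carrier_mat n n" "A = A * A * G" and H: "H \<in> carrier_mat n n" "A = H * A * A"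
    using mat_rank_square_factors[OF A mat_rank_square_if_index_1[OF A index]] by blast
  note dims = carrier_matD[OF A] carrier_matD[OF P] carrier_matD[OF U(1)] carrier_matD[OF G(1)]
    carrier_matD[OF H(1)] carrier_matD[OF Yc]
  have "Y = U * (A * A * G)" by (simp only: G(2)[symmetric] U(2)[symmetric])
  also have "\<dots> = Y * A * G" unfolding U(2) using dims by (simp only: mult_assoc_dim index_mult_mat)
  finally have YPAG: "Y = P * A * G" unfolding YA .
  then have "A * A * Y = A * A * (P * A * G)" by simp
  also have "\<dots> = A * (A * P * A) * G" using dims by (simp only: mult_assoc_dim index_mult_mat)
  finally show "A * A * Y = A" unfolding APA G(2)[symmetric] .
  have "P * A = mat_adjoint (P * (H * A * A))" by (simp only: H(2)[symmetric] PA)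
  also have "P * (H * A * A) = P * H * (A * A)"
    using dims by (simp only: mult_assoc_dim index_mult_mat)
  also have "mat_adjoint (P * H * (A * A)) = mat_adjoint (A * A) * mat_adjoint (P * H)"
    using dims by (simp only: mat_adjoint_mult[of "P * H" "A * A"] index_mult_mat)
  finally have PA': "P * A = mat_adjoint (A * A) * mat_adjoint (P * H)" .
  have "Y = mat_adjoint (A * A) * mat_adjoint (P * H) * G" by (simp only: YPAG PA')
  also have "\<dots> = mat_adjoint (A * A) * (mat_adjoint (P * H) * G)"
    using dims by (simp only: mult_assoc_dim index_mult_mat dim_mat_adjoint)
  finally show "\<exists>Z\<in>carrier_mat n n. Y = mat_adjoint (A * A) * Z"
    using dims by (intro bexI[of _ "mat_adjoint (P * H) * G"] carrier_matI) simp_all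
qed

text \<open>In the core EP formulas the minors have order r = rk A^k, which is also the rank of
  A^(k+1). For k at most 1 this equals s; for k at least 2 it is smaller, and every minor of order s
  of A^(k+1) times its adjoint vanishes, so the denominators would be zero at that order.\<close>

theorem corollary3p3:
  fixes A :: "complex mat" and n k r s :: nat
  assumes A_dim: "A \<in> carrier_mat n n"
    and rank_A: "mat_rank A = s"
    and index_A: "mat_index A = k"
    and rank_A_pow: "mat_rank (A ^\<^sub>m k) = r"
  shows
    "(\<forall>X. is_right_core_EP_inverse A X \<longrightarrow>
       (\<forall>i<n. \<forall>j<n. X $$ (i, j) =
         (\<Sum>\<alpha>\<in>index_sets_at r n j.
            principal_minor
              (replace_row (A ^\<^sub>m (k + 1) * mat_adjoint (A ^\<^sub>m (k + 1)))
                 (row (A ^\<^sub>m k * mat_adjoint (A ^\<^sub>m (k + 1))) i) j) \<alpha>) /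
         (\<Sum>\<alpha>\<in>index_sets r n.
            principal_minor (A ^\<^sub>m (k + 1) * mat_adjoint (A ^\<^sub>m (k + 1))) \<alpha>))) \<and>
     (\<forall>Y. is_left_core_EP_inverse A Y \<longrightarrow>
       (\<forall>i<n. \<forall>j<n. Y $$ (i, j) =
         (\<Sum>\<beta>\<in>index_sets_at r n i.
            principal_minor
              (replace_col (mat_adjoint (A ^\<^sub>m (k + 1)) * A ^\<^sub>m (k + 1))
                 (col (mat_adjoint (A ^\<^sub>m (k + 1)) * A ^\<^sub>m k) j) i) \<beta>) /
         (\<Sum>\<beta>\<in>index_sets r n.
            principal_minor (mat_adjoint (A ^\<^sub>m (k + 1)) * A ^\<^sub>m (k + 1)) \<beta>))) \<and>
     (mat_index A = 1 \<longrightarrow>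
       (\<forall>X'. is_right_core_inverse A X' \<longrightarrow>
         (\<forall>i<n. \<forall>j<n. X' $$ (i, j) =
           (\<Sum>\<alpha>\<in>index_sets_at s n j.
              principal_minor
                (replace_row (A ^\<^sub>m 2 * mat_adjoint (A ^\<^sub>m 2))
                   (row (A * mat_adjoint (A ^\<^sub>m 2)) i) j) \<alpha>) /
           (\<Sum>\<alpha>\<in>index_sets s n.
              principal_minor (A ^\<^sub>m 2 * mat_adjoint (A ^\<^sub>m 2)) \<alpha>))) \<and>
       (\<forall>Y'. is_left_core_inverse A Y' \<longrightarrow>
         (\<forall>i<n. \<forall>j<n. Y' $$ (i, j) =
           (\<Sum>\<beta>\<in>index_sets_at s n i.
              principal_minor
                (replace_col (mat_adjoint (A ^\<^sub>m 2) * A ^\<^sub>m 2)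
                   (col (mat_adjoint (A ^\<^sub>m 2) * A) j) i) \<beta>) /
           (\<Sum>\<beta>\<in>index_sets s n.
              principal_minor (mat_adjoint (A ^\<^sub>m 2) * A ^\<^sub>m 2) \<beta>))))"
proof (intro conjI allI impI)
  have B: "A ^\<^sub>m (k + 1) \<in> carrier_mat n n" and AA: "A * A \<in> carrier_mat n n"
    using pow_carrier_mat[OF A_dim] mult_carrier_mat[OF A_dim A_dim] by blast+
  \<comment> \<open>By the definition of the index the rank does not drop from exponent k to k + 1,
    so the order of the minors matches the rank of the matrix to be factored.\<close>
  have rank_B: "mat_rank (A ^\<^sub>m (k + 1)) = r"
    using mat_rank_pow_index[OF A_dim] index_A rank_A_pow by simp
  note sq = pow_mat_2[OF A_dim]
  fix i j assume i: "i < n" and j: "j < n"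
  {
    fix X assume "is_right_core_EP_inverse A X"
    from right_core_EP_inverse_pow[OF A_dim this] index_A
    obtain Z where Z: "X * A ^\<^sub>m (k + 1) = A ^\<^sub>m k" "Z \<in> carrier_mat n n"
      "X = Z * mat_adjoint (A ^\<^sub>m (k + 1))" by blast
    show "X $$ (i, j) =
         (\<Sum>\<alpha>\<in>index_sets_at r n j.
            principal_minor
              (replace_row (A ^\<^sub>m (k + 1) * mat_adjoint (A ^\<^sub>m (k + 1)))
                 (row (A ^\<^sub>m k * mat_adjoint (A ^\<^sub>m (k + 1))) i) j) \<alpha>) /
         (\<Sum>\<alpha>\<in>index_sets r n.
            principal_minor (A ^\<^sub>m (k + 1) * mat_adjoint (A ^\<^sub>m (k + 1))) \<alpha>)"
      by (rule determinantal_representation_row[OF B rank_B Z(2,3,1) i j])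
  next
    fix Y assume "is_left_core_EP_inverse A Y"
    from left_core_EP_inverse_pow[OF A_dim this] index_A
    obtain Z where Z: "A ^\<^sub>m (k + 1) * Y = A ^\<^sub>m k" "Z \<in> carrier_mat n n"
      "Y = mat_adjoint (A ^\<^sub>m (k + 1)) * Z" by blast
    show "Y $$ (i, j) =
         (\<Sum>\<beta>\<in>index_sets_at r n i.
            principal_minor
              (replace_col (mat_adjoint (A ^\<^sub>m (k + 1)) * A ^\<^sub>m (k + 1))
                 (col (mat_adjoint (A ^\<^sub>m (k + 1)) * A ^\<^sub>m k) j) i) \<beta>) /
         (\<Sum>\<beta>\<in>index_sets r n.
            principal_minor (mat_adjoint (A ^\<^sub>m (k + 1)) * A ^\<^sub>m (k + 1)) \<beta>)"
      by (rule determinantal_representation_col[OF B rank_B Z(2,3,1) i j])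
  next
    fix X assume index: "mat_index A = 1" and "is_right_core_inverse A X"
    from right_core_inverse_square[OF A_dim this]
    obtain Z where Z: "X * (A * A) = A" "Z \<in> carrier_mat n n" "X = Z * mat_adjoint (A * A)" by blast
    have "mat_rank (A * A) = s" using mat_rank_square_if_index_1[OF A_dim index] rank_A by simp
    from determinantal_representation_row[OF AA this Z(2,3,1) i j]
    show "X $$ (i, j) =
           (\<Sum>\<alpha>\<in>index_sets_at s n j.
              principal_minor
                (replace_row (A ^\<^sub>m 2 * mat_adjoint (A ^\<^sub>m 2))
                   (row (A * mat_adjoint (A ^\<^sub>m 2)) i) j) \<alpha>) /
           (\<Sum>\<alpha>\<in>index_sets s n.
              principal_minor (A ^\<^sub>m 2 * mat_adjoint (A ^\<^sub>m 2)) \<alpha>)"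
      unfolding sq .
  next
    fix Y assume index: "mat_index A = 1" and "is_left_core_inverse A Y"
    from left_core_inverse_square[OF A_dim this]
    obtain Z where Z: "A * A * Y = A" "Z \<in> carrier_mat n n" "Y = mat_adjoint (A * A) * Z" by blast
    have "mat_rank (A * A) = s" using mat_rank_square_if_index_1[OF A_dim index] rank_A by simp
    from determinantal_representation_col[OF AA this Z(2,3,1) i j]
    show "Y $$ (i, j) =
           (\<Sum>\<beta>\<in>index_sets_at s n i.
              principal_minor
                (replace_col (mat_adjoint (A ^\<^sub>m 2) * A ^\<^sub>m 2)
                   (col (mat_adjoint (A ^\<^sub>m 2) * A) j) i) \<beta>) /
           (\<Sum>\<beta>\<in>index_sets s n.
              principal_minor (mat_adjoint (A ^\<^sub>m 2) * A ^\<^sub>m 2) \<beta>)"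
      unfolding sq .
  }
qed

end
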